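(* Let $\mathfrak{L}$ be the thin Lie algebra over $\mathbb{C}$ with basis $\{e_i\}_{i\in\mathbb{N}}$, let $L:\mathfrak{L}\to\mathfrak{L}$, $L(x)=[e_1,x]$, be the operator of left multiplication by $e_1$, and let $\varphi$ be a $\frac12$-derivation of $\mathfrak{L}$. Then there are complex numbers $\{\alpha_i\}_{i\in\mathbb{N}}$ and $\{\beta_i\}_{i\in\mathbb{N}}$ (only finitely many nonzero) such that $$\varphi(e_1)=\sum_{i\in\mathbb{N}}\alpha_ie_i,\qquad \varphi(e_2)=\sum_{i\in\mathbb{N}}\beta_ie_i,\qquad \varphi(e_n)=(1-2^{2-n})\alpha_1e_n+2^{2-n}L^{n-2}\varphi(e_2)\quad(n\ge2).$$
   Context: $\mathbb{N}=\{1,2,3,\ldots\}$. The thin Lie algebra has basis $\{e_i\}_{i\in\mathbb{N}}$ and brackets $[e_1,e_n]=e_{n+1}$ for $n>1$, all other brackets of basis elements (up to skew-symmetry) being zero. A $\frac12$-derivation of a Lie algebra $\mathfrak{L}$ is a linear map $\varphi:\mathfrak{L}\to\mathfrak{L}$ with $\varphi([x,y])=\frac12\left([\varphi(x),y]+[x,\varphi(y)]\right)$ for all $x,y$. *)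

theory Defs
  imports Complex_Main "HOL-Computational_Algebra.Polynomial"
begin

locale lie_algebra = vector_space scale
  for scale :: "'k::field \<Rightarrow> 'a::ab_group_add \<Rightarrow> 'a" +
  fixes bracket :: "'a \<Rightarrow> 'a \<Rightarrow> 'a"
  assumes linear_bracket_right: "Vector_Spaces.linear scale scale (\<lambda>y. bracket x y)"
    and linear_bracket_left: "Vector_Spaces.linear scale scale (\<lambda>x. bracket x y)"
    and bracket_self: "bracket x x = 0"
    and jacobi: "bracket x (bracket y z) + bracket y (bracket z x) + bracket z (bracket x y) = 0"
begin

definition half_derivation :: "('a \<Rightarrow> 'a) \<Rightarrow> bool" where
  "half_derivation \<phi> \<longleftrightarrow> Vector_Spaces.linear scale scale \<phi> \<and>
     (\<forall>x y. \<phi> (bracket x y) = scale (1 / 2) (bracket (\<phi> x) y + bracket x (\<phi> y)))"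

end

text \<open>
  The basis is indexed by the positive integers; the value \<open>e 0\<close> is unconstrained and irrelevant.
  Together with bilinearity and the alternating law, the two bracket equations determine
  the bracket completely.
\<close>

locale thin_lie_algebra = lie_algebra scale bracket
  for scale :: "'k::field \<Rightarrow> 'a::ab_group_add \<Rightarrow> 'a"
    and bracket :: "'a \<Rightarrow> 'a \<Rightarrow> 'a" +
  fixes e :: "nat \<Rightarrow> 'a"
  assumes inj_basis: "inj_on e {1..}"
    and independent_basis: "independent (e ` {1..})"
    and span_basis: "span (e ` {1..}) = UNIV"
    and bracket_e1: "n > 1 \<Longrightarrow> bracket (e 1) (e n) = e (n + 1)"
    and bracket_zero: "m > 1 \<Longrightarrow> n > 1 \<Longrightarrow> bracket (e m) (e n) = 0"

text \<open>
  The axioms are consistent: polynomials, with \<open>e n\<close> the monomial of degree \<open>n - 1\<close>, form a model.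
\<close>

lemma thin_lie_algebra_poly:
  "thin_lie_algebra (smult :: 'k::field \<Rightarrow> 'k poly \<Rightarrow> 'k poly)
     (\<lambda>p q. smult (coeff p 0) (pCons 0 (q - [:coeff q 0:])) - smult (coeff q 0) (pCons 0 (p - [:coeff p 0:])))
     (\<lambda>n. monom 1 (n - 1))"
proof -
  interpret vector_space "smult :: 'k \<Rightarrow> 'k poly \<Rightarrow> 'k poly"
    by unfold_locales (simp_all add: smult_add_right smult_add_left)
  have mon: "(\<lambda>n. monom (1::'k) (n - 1)) ` {1..} = range (monom 1)"
  proof -
    have "monom (1::'k) n \<in> (\<lambda>n. monom (1::'k) (n - 1)) ` {1..}" for n
      by (rule image_eqI[where x = "Suc n"]) auto
    then show ?thesis by auto
  qed
  have ind: "independent (range (monom (1::'k)))"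
    unfolding dependent_explicit
  proof (safe)
    fix S :: "'k poly set" and u v
    assume fin: "finite S" and S: "S \<subseteq> range (monom 1)" and s: "(\<Sum>v\<in>S. smult (u v) v) = 0"
      and v: "v \<in> S" "u v \<noteq> 0"
    obtain n where n: "v = monom 1 n" using S v by auto
    have "0 = coeff (\<Sum>w\<in>S. smult (u w) w) n" using s by simp
    also have "\<dots> = (\<Sum>w\<in>S. u w * coeff w n)" by (simp add: coeff_sum)
    also have "\<dots> = (\<Sum>w\<in>S. if w = v then u v else 0)"
    proof (rule sum.cong[OF refl])
      fix w assume "w \<in> S"
      then obtain m where "w = monom 1 m" using S by auto
      then show "u w * coeff w n = (if w = v then u v else 0)"
        using n by (auto simp: monom_eq_iff')
    qed
    also have "\<dots> = u v" using fin v by simp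
    finally show False using v by simp
  qed
  have spn: "p \<in> span (range (monom (1::'k)))" for p
  proof -
    have "p = (\<Sum>i\<le>degree p. smult (coeff p i) (monom 1 i))"
      by (simp add: smult_monom poly_as_sum_of_monoms)
    also have "\<dots> \<in> span (range (monom 1))"
      by (intro span_sum span_scale span_base) auto
    finally show ?thesis .
  qed
  have lin: "Vector_Spaces.linear smult smult f"
    if "\<And>p q. f (p + q) = f p + f q" "\<And>c p. f (smult c p) = smult c (f p)"
    for f :: "'k poly \<Rightarrow> 'k poly"
    using that vector_space_axioms by (simp add: Vector_Spaces.linear_iff)
  define B where "B = (\<lambda>p q :: 'k poly. smult (coeff p 0) (pCons 0 (q - [:coeff q 0:]))
                          - smult (coeff q 0) (pCons 0 (p - [:coeff p 0:])))"
  have coeff_B: "coeff (B p q) n = (case n of Suc (Suc k) \<Rightarrow>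
      coeff p 0 * coeff q (Suc k) - coeff q 0 * coeff p (Suc k) | _ \<Rightarrow> 0)" for p q n
    by (auto simp: B_def coeff_pCons split: nat.splits)
  have "lie_algebra smult B"
  proof (rule lie_algebra.intro[OF vector_space_axioms lie_algebra_axioms.intro])
    show "Vector_Spaces.linear smult smult (\<lambda>y. B x y)" for x
      by (rule lin) (auto intro!: poly_eqI simp: coeff_B algebra_simps split: nat.splits)
    show "Vector_Spaces.linear smult smult (\<lambda>x. B x y)" for y
      by (rule lin) (auto intro!: poly_eqI simp: coeff_B algebra_simps split: nat.splits)
    show "B x x = 0" for x
      by (simp add: B_def)
    show "B x (B y z) + B y (B z x) + B z (B x y) = 0" for x y z
      by (rule poly_eqI) (auto simp: coeff_B algebra_simps split: nat.splits)
  qed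
  then interpret lie_algebra smult B .
  have "thin_lie_algebra smult B (\<lambda>n. monom 1 (n - 1))"
  proof (rule thin_lie_algebra.intro[OF lie_algebra_axioms thin_lie_algebra_axioms.intro])
    show "inj_on (\<lambda>n. monom (1::'k) (n - 1)) {1..}"
      by (auto simp: inj_on_def monom_eq_iff')
    show "independent ((\<lambda>n. monom (1::'k) (n - 1)) ` {1..})"
      using ind mon by simp
    show "span ((\<lambda>n. monom (1::'k) (n - 1)) ` {1..}) = UNIV"
      using spn mon by auto
    show "B (monom 1 (1 - 1)) (monom 1 (n - 1)) = monom 1 (n + 1 - 1)" if "n > 1" for n
      using that by (auto intro!: poly_eqI simp: coeff_B split: nat.splits)
    show "B (monom 1 (m - 1)) (monom 1 (n - 1)) = 0" if "m > 1" "n > 1" for m n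
      using that by (auto intro!: poly_eqI simp: coeff_B split: nat.splits)
  qed
  then show ?thesis
    by (simp add: B_def)
qed

end

theory Submission
  imports Defs
begin

text \<open>
  Write \<open>\<phi> (e 1) = \<Sum>i. \<alpha> i e i\<close>. The bracket of \<open>e i\<close> with \<open>e n\<close>, \<open>n \<ge> 2\<close>, vanishes unless \<open>i = 1\<close>, so of
  all the coefficients of \<open>\<phi> (e 1)\<close> only \<open>\<alpha> 1\<close> is visible in \<open>[\<phi> (e 1), e n] = \<alpha> 1 e (n + 1)\<close>
  (lemma \<open>bracket_basis_expansion\<close>). Applying \<open>\<phi>\<close> to \<open>e (n + 1) = [e 1, e n]\<close> therefore gives the
  recurrence
  \<open>\<phi> (e (n + 1)) = 1/2 (\<alpha> 1 e (n + 1) + L (\<phi> (e n)))\<close>.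
  Each step halves the part that comes from \<open>\<phi> (e 2)\<close> and shifts it by \<open>L\<close>. The part along \<open>e n\<close> has a
  coefficient \<open>c n\<close> with \<open>c 2 = 0\<close> and \<open>c (n + 1) = (c n + \<alpha> 1) / 2\<close>, whose distance to the
  fixed point \<open>\<alpha> 1\<close> halves at each step; hence \<open>c n = (1 - 2 powi (2 - n)) \<alpha> 1\<close>
  (lemma \<open>half_derivation_basis\<close>).
\<close>

context thin_lie_algebra
begin

text \<open>
  The basis is a set of vectors for the notion of representation, whereas coordinates indexed by
  positive integers are wanted; injectivity of \<open>e\<close> on these transfers the sum over basis vectors to
  a sum over indices.
\<close>

lemma basis_expansion:
  obtains \<alpha> :: "nat \<Rightarrow> 'k"
  where "finite {i. 1 \<le> i \<and> \<alpha> i \<noteq> 0}"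
    and "x = (\<Sum>i | 1 \<le> i \<and> \<alpha> i \<noteq> 0. scale (\<alpha> i) (e i))"
proof -
  let ?B = "e ` {1..}"
  define r where "r = representation ?B x"
  let ?I = "{i. 1 \<le> i \<and> r (e i) \<noteq> 0}"
  have img: "{b. r b \<noteq> 0} = e ` ?I"
    using representation_ne_zero[of ?B x] by (auto simp: r_def)
  have inj: "inj_on e ?I"
    using inj_basis by (rule inj_on_subset) auto
  have "finite {b. r b \<noteq> 0}"
    unfolding r_def by (rule finite_representation)
  then have fin: "finite ?I"
    using img inj finite_image_iff by metis
  have "x = (\<Sum>b | r b \<noteq> 0. scale (r b) b)"
    using sum_nonzero_representation_eq[OF independent_basis, of x] span_basis by (simp add: r_def)
  also have "\<dots> = (\<Sum>i\<in>?I. scale (r (e i)) (e i))"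
    unfolding img using inj by (simp add: sum.reindex)
  finally show thesis
    using that[of "\<lambda>i. r (e i)"] fin by simp
qed

text \<open>
  A derivation-like identity sees \<open>\<phi> (e 1)\<close> only through these brackets: the elements \<open>e i\<close> with
  \<open>i \<ge> 2\<close> span an abelian ideal that contains \<open>e n\<close>, so only the first coordinate survives.
\<close>

lemma bracket_basis_expansion:
  assumes fin: "finite {i. 1 \<le> i \<and> \<alpha> i \<noteq> 0}"
    and n: "2 \<le> n"
  shows "bracket (\<Sum>i | 1 \<le> i \<and> \<alpha> i \<noteq> 0. scale (\<alpha> i) (e i)) (e n) = scale (\<alpha> 1) (e (Suc n))"
proof -
  let ?I = "{i. 1 \<le> i \<and> \<alpha> i \<noteq> 0}"
  interpret left: Vector_Spaces.linear scale scale "\<lambda>x. bracket x (e n)"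
    by (rule linear_bracket_left)
  have "bracket (\<Sum>i\<in>?I. scale (\<alpha> i) (e i)) (e n) = (\<Sum>i\<in>?I. scale (\<alpha> i) (bracket (e i) (e n)))"
    by (simp only: left.sum left.scale)
  also have "\<dots> = (\<Sum>i\<in>?I. if i = 1 then scale (\<alpha> 1) (e (Suc n)) else 0)"
  proof (rule sum.cong[OF refl])
    fix i assume "i \<in> ?I"
    then show "scale (\<alpha> i) (bracket (e i) (e n)) = (if i = 1 then scale (\<alpha> 1) (e (Suc n)) else 0)"
      using bracket_e1[of n] bracket_zero[of i n] n by (cases "i = 1") simp_all
  qed
  also have "\<dots> = scale (\<alpha> 1) (e (Suc n))"
    using fin by simp
  finally show ?thesis .
qed

text \<open>
  Since \<open>e (n + 1) = [e 1, e n]\<close> for \<open>n \<ge> 2\<close>, the values of \<open>\<phi>\<close> on the basis are determined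
  recursively by \<open>\<phi> (e 1)\<close> and \<open>\<phi> (e 2)\<close>; this solves the recursion. Characteristic two is excluded
  because the step uses \<open>1/2 + 1/2 = 1\<close>.
\<close>

lemma half_derivation_basis:
  assumes two: "(2::'k) \<noteq> 0"
    and der: "half_derivation \<phi>"
    and fin: "finite {i. 1 \<le> i \<and> \<alpha> i \<noteq> 0}"
    and \<phi>_e1: "\<phi> (e 1) = (\<Sum>i | 1 \<le> i \<and> \<alpha> i \<noteq> 0. scale (\<alpha> i) (e i))"
    and n: "2 \<le> n"
  shows "\<phi> (e n) = scale ((1 - 2 powi (2 - int n)) * \<alpha> 1) (e n)
              + scale (2 powi (2 - int n)) ((bracket (e 1) ^^ (n - 2)) (\<phi> (e 2)))"
  using n
proof (induction n rule: dec_induct)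
  case base
  show ?case by simp
next
  case (step n)
  interpret L: Vector_Spaces.linear scale scale "bracket (e 1)"
    by (rule linear_bracket_right)
  let ?p = "2 powi (2 - int n) :: 'k"
  let ?v = "(bracket (e 1) ^^ (n - 2)) (\<phi> (e 2))"
  have p: "2 powi (2 - int (Suc n)) = ?p / 2"
    using power_int_diff[of "2::'k" "2 - int n" 1] two by (simp add: algebra_simps)
  have v: "(bracket (e 1) ^^ (Suc n - 2)) (\<phi> (e 2)) = bracket (e 1) ?v"
    by (simp only: Suc_diff_le[OF step.hyps(1)] funpow.simps comp_apply)
  have e_Suc: "bracket (e 1) (e n) = e (Suc n)"
    using bracket_e1[of n] step.hyps by simp
  have "\<phi> (e (Suc n)) = scale (1/2) (bracket (\<phi> (e 1)) (e n) + bracket (e 1) (\<phi> (e n)))"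
    using der unfolding half_derivation_def e_Suc[symmetric] by blast
  also have "bracket (\<phi> (e 1)) (e n) = scale (\<alpha> 1) (e (Suc n))"
    unfolding \<phi>_e1 using fin step.hyps(1) by (rule bracket_basis_expansion)
  also have "bracket (e 1) (\<phi> (e n))
      = scale ((1 - ?p) * \<alpha> 1) (e (Suc n)) + scale ?p (bracket (e 1) ?v)"
    by (simp only: step.IH L.add L.scale e_Suc)
  also have "scale (1/2) (scale (\<alpha> 1) (e (Suc n)) + \<dots>)
      = scale (1/2 * (\<alpha> 1 + (1 - ?p) * \<alpha> 1)) (e (Suc n)) + scale (?p / 2) (bracket (e 1) ?v)"
    by (simp add: scale_right_distrib scale_left_distrib add.assoc distrib_left)
  also have "1/2 * (\<alpha> 1 + (1 - ?p) * \<alpha> 1) = (1 - ?p / 2) * \<alpha> 1"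
    using two by (simp add: field_simps)
  finally show ?case
    by (simp only: p v)
qed

end

theorem lemma35:
  fixes scale :: "complex \<Rightarrow> 'a::ab_group_add \<Rightarrow> 'a"
    and bracket :: "'a \<Rightarrow> 'a \<Rightarrow> 'a"
    and e :: "nat \<Rightarrow> 'a"
    and L \<phi> :: "'a \<Rightarrow> 'a"
  assumes "thin_lie_algebra scale bracket e"
    and "\<And>x. L x = bracket (e 1) x"
    and "lie_algebra.half_derivation scale bracket \<phi>"
  shows "\<exists>\<alpha> \<beta> :: nat \<Rightarrow> complex.
    finite {i. 1 \<le> i \<and> \<alpha> i \<noteq> 0} \<and> finite {i. 1 \<le> i \<and> \<beta> i \<noteq> 0} \<and>
    \<phi> (e 1) = (\<Sum>i | 1 \<le> i \<and> \<alpha> i \<noteq> 0. scale (\<alpha> i) (e i)) \<and>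
    \<phi> (e 2) = (\<Sum>i | 1 \<le> i \<and> \<beta> i \<noteq> 0. scale (\<beta> i) (e i)) \<and>
    (\<forall>n::nat. 2 \<le> n \<longrightarrow>
      \<phi> (e n) = scale ((1 - 2 powi (2 - int n)) * \<alpha> 1) (e n)
              + scale (2 powi (2 - int n)) ((L ^^ (n - 2)) (\<phi> (e 2))))"
proof -
  interpret thin_lie_algebra scale bracket e by fact
  have L: "L = bracket (e 1)"
    using assms(2) by (rule ext)
  obtain \<alpha> where \<alpha>: "finite {i. 1 \<le> i \<and> \<alpha> i \<noteq> 0}"
      "\<phi> (e 1) = (\<Sum>i | 1 \<le> i \<and> \<alpha> i \<noteq> 0. scale (\<alpha> i) (e i))"
    by (rule basis_expansion)
  obtain \<beta> where \<beta>: "finite {i. 1 \<le> i \<and> \<beta> i \<noteq> 0}"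
      "\<phi> (e 2) = (\<Sum>i | 1 \<le> i \<and> \<beta> i \<noteq> 0. scale (\<beta> i) (e i))"
    by (rule basis_expansion)
  have "\<forall>n::nat. 2 \<le> n \<longrightarrow>
      \<phi> (e n) = scale ((1 - 2 powi (2 - int n)) * \<alpha> 1) (e n)
              + scale (2 powi (2 - int n)) ((L ^^ (n - 2)) (\<phi> (e 2)))"
    unfolding L by (intro allI impI half_derivation_basis[OF _ assms(3) \<alpha>]) simp_all
  then show ?thesis
    by (intro exI[of _ \<alpha>] exI[of _ \<beta>] conjI \<alpha> \<beta>)
qed

end
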